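(* Let $k\ge 1$ and $k\le r\le 2k$ be integers. The series $$t_\infty^{(r)}=\lim_{i\to\infty}t_i^{(r)}=\frac{s_1^{(r)}}{2k+2}+\sum_{i=2}^\infty u_i^{(r)}$$ is absolutely convergent, and for every $n\ge 2$ its $n$-th error term $$R_n=\sum_{i\ge n}u_i^{(r)}=t_\infty^{(r)}-t_{n-1}^{(r)}$$ satisfies the superexponential upper bound $$|R_n|\le\frac{Mke^2\cdot 2^{p_n}}{p_n!},$$ where $n=p_nk+s$ with integers $p_n\ge 0$ and $2\le s\le k+1$, and $M=M_{k,r}=\max\left\{|u_m^{(r)}| : 2\le m\le 2k\right\}$.
   Context: Parking process. Fix an integer $k\ge 1$. For an integer $n\ge 1$ consider a row of $n+k-1$ parking slots labelled $1,2,\dots,n+k-1$. Cars arrive one by one. At any stage a slot is available if, after occupying it, every gap between neighboring occupied slots, as well as the gap before the first occupied slot and the gap after the last occupied slot, contains at least $k$ unoccupied slots (equivalently, distinct occupied slots are at distance at least $k+1$ and there are at least $k$ unoccupied slots at each end of the row). Each arriving car occupies one of the currently available slots, chosen uniformly at random among them (given the past). The process stops when no slot is available. A gap is a maximal block of consecutive unoccupied slots in the final configuration (between neighboring cars, before the first car, or after the last car; if no car can park, the whole row is a single gap). The final gaps have sizes in $\{k,k+1,\dots,2k\}$; an $r$-gap is a gap consisting of exactly $r$ slots. For $k\le r\le 2k$ and $n\ge 1$, $a_n^{(r)}$ denotes the expected number of $r$-gaps at the end of the process on the row of $n+k-1$ slots. Notation. For $n\ge 1$: $s_n^{(r)}=\sum_{i=1}^n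 a_i^{(r)}$ (so $s_1^{(r)}=1$ if $r=k$ and $s_1^{(r)}=0$ if $k<r\le 2k$) and $t_n^{(r)}=\dfrac{s_n^{(r)}}{n(n+2k+1)}$. For $n\ge 2$: $u_n^{(r)}=t_n^{(r)}-t_{n-1}^{(r)}$. *)

theory Defs
  imports "HOL-Probability.Probability"
begin

text \<open>
  The row consists of the slots \<open>1, \<dots>, N\<close>, and a configuration is the set \<open>S\<close> of occupied slots.
  A gap is represented by the pair \<open>(l, r)\<close> of its delimiters, where \<open>0\<close> and \<open>N + 1\<close> serve as
  sentinels for the two ends of the row; the gap itself is the block \<open>{l<..<r}\<close>. Gaps of
  size \<open>0\<close> (neighbouring cars without a free slot between them) are included, so that they are
  seen by the availability condition.
\<close>

definition gaps :: "nat \<Rightarrow> nat set \<Rightarrow> (nat \<times> nat) set" where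
  "gaps N S = {(l, r). l \<in> insert 0 S \<and> r \<in> insert (N + 1) S \<and> l < r \<and> S \<inter> {l<..<r} = {}}"

definition gap_size :: "nat \<times> nat \<Rightarrow> nat" where
  "gap_size g = card {fst g<..<snd g}"

definition available :: "nat \<Rightarrow> nat \<Rightarrow> nat set \<Rightarrow> nat set" where
  "available k N S = {x \<in> {1..N} - S. \<forall>g \<in> gaps N (insert x S). k \<le> gap_size g}"

text \<open>The distribution of the final configuration when the process is started from \<open>S\<close>.\<close>

function parking :: "nat \<Rightarrow> nat \<Rightarrow> nat set \<Rightarrow> nat set pmf" where
  "parking k N S =
     (if available k N S = {} then return_pmf S
      else bind_pmf (pmf_of_set (available k N S)) (\<lambda>x. parking k N (insert x S)))"
  by pat_completeness auto

lemma finite_available: "finite (available k N S)"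
  by (simp add: available_def)

termination
proof (relation "Wellfounded.measure (\<lambda>(k, N, S). card ({1..N} - S))", goal_cases)
  case (2 k N S x)
  then have "x \<in> {1..N} - S"
    by (auto simp: set_pmf_of_set finite_available available_def)
  then have "{1..N} - insert x S \<subset> {1..N} - S"
    by blast
  then show ?case
    by (simp add: psubset_card_mono)
qed simp

declare parking.simps [simp del]

definition num_gaps :: "nat \<Rightarrow> nat \<Rightarrow> nat set \<Rightarrow> nat" where
  "num_gaps r N S = card {g \<in> gaps N S. gap_size g = r}"

text \<open>The sequences are only meaningful for \<open>n \<ge> 1\<close> (\<open>n \<ge> 2\<close> for \<open>u_seq\<close>).\<close>

definition a_seq :: "nat \<Rightarrow> nat \<Rightarrow> nat \<Rightarrow> real" where
  "a_seq k r n =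
     measure_pmf.expectation (parking k (n + k - 1) {}) (\<lambda>S. real (num_gaps r (n + k - 1) S))"

definition s_seq :: "nat \<Rightarrow> nat \<Rightarrow> nat \<Rightarrow> real" where
  "s_seq k r n = (\<Sum>i=1..n. a_seq k r i)"

definition t_seq :: "nat \<Rightarrow> nat \<Rightarrow> nat \<Rightarrow> real" where
  "t_seq k r n = s_seq k r n / real (n * (n + 2 * k + 1))"

definition u_seq :: "nat \<Rightarrow> nat \<Rightarrow> nat \<Rightarrow> real" where
  "u_seq k r n = t_seq k r n - t_seq k r (n - 1)"

definition t_inf :: "nat \<Rightarrow> nat \<Rightarrow> real" where
  "t_inf k r = lim (t_seq k r)"

definition error_term :: "nat \<Rightarrow> nat \<Rightarrow> nat \<Rightarrow> real" where
  "error_term k r n = (\<Sum>i. u_seq k r (n + i))"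

definition M_const :: "nat \<Rightarrow> nat \<Rightarrow> real" where
  "M_const k r = Max ((\<lambda>m. \<bar>u_seq k r m\<bar>) ` {2..2 * k})"

end

theory Submission
  imports Defs
begin

text \<open>
  The first car splits the row into two independent parking processes, which gives
  \<open>n a\<^bsub>n+k+1\<^esub> = 2 s\<^sub>n\<close>. The sequence \<open>q\<^sub>n = n (n + 2k + 1)\<close> satisfies the
  resulting recursion for \<open>s\<^sub>n\<close>, so dividing by it (reduction of order) leaves the homogeneous
  recursion \<open>q\<^sub>N u\<^sub>N = - 2 (N + k) (u\<^bsub>N-k\<^esub> + \<dots> + u\<^bsub>N-1\<^esub>)\<close>. Hence
  \<open>\<bar>u\<^sub>N\<bar>\<close> is at most \<open>2k / N\<close> times the maximum of the previous \<open>k\<close> terms, and each block of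
  \<open>k\<close> terms gains a factor \<open>2 / p\<close> over the preceding one.
\<close>

section \<open>Expected numbers of gaps\<close>

text \<open>Expected number of \<open>r\<close>-gaps left by an empty row of \<open>L\<close> slots,
  conditioned on the first car. It is uniform on the \<open>L - 2 * k\<close> slots of the index
  set, and a car at \<open>x\<close> leaves rows of \<open>x - 1\<close> and \<open>L - x\<close>
  slots. If \<open>L \<le> 2 * k\<close>, no car fits and the row is itself the gap.\<close>

function expected_gaps :: "nat \<Rightarrow> nat \<Rightarrow> nat \<Rightarrow> real" where
  "expected_gaps k r L =
     (if L \<le> 2 * k then of_bool (L = r)
      else (\<Sum>x\<in>{k<..<L + 1 - k}. expected_gaps k r (x - 1) + expected_gaps k r (L - x))
             / real (L - 2 * k))"
  by pat_completeness auto
termination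
  by (relation "Wellfounded.measure (\<lambda>(k, r, L). L)") auto

declare expected_gaps.simps [simp del]

section \<open>Gaps of a configuration and how one more car changes them\<close>

lemma gap_size_Pair [simp]: "gap_size (l, r) = r - l - 1"
  by (simp add: gap_size_def)

lemma mem_gaps:
  "(l, r) \<in> gaps N S \<longleftrightarrow>
     (l = 0 \<or> l \<in> S) \<and> (r = N + 1 \<or> r \<in> S) \<and> l < r \<and> (\<forall>y\<in>S. \<not> (l < y \<and> y < r))"
  by (auto simp: gaps_def)

lemma finite_gaps:
  assumes "S \<subseteq> {1..N}"
  shows "finite (gaps N S)"
proof (rule finite_subset)
  show "gaps N S \<subseteq> {0..N} \<times> {0..N + 1}"
    using assms by (auto simp: gaps_def)
qed simp

lemma gap_around_exists:
  assumes "S \<subseteq> {1..N}" and "x \<in> {1..N} - S"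
  obtains l r where "(l, r) \<in> gaps N S" and "l < x" and "x < r"
proof -
  define l where "l = Max {y \<in> insert 0 S. y < x}"
  define r where "r = Min {y \<in> insert (N + 1) S. x < y}"
  have fin: "finite S"
    using assms(1) finite_subset by blast
  have l: "l \<in> {y \<in> insert 0 S. y < x}"
    unfolding l_def using fin assms(2) by (intro Max_in) auto
  have r: "r \<in> {y \<in> insert (N + 1) S. x < y}"
    unfolding r_def using fin assms(2) by (intro Min_in) auto
  have l_max: "y \<le> l" if "y \<in> S" "y < x" for y
    unfolding l_def using fin that by (intro Max_ge) auto
  have r_min: "r \<le> y" if "y \<in> S" "x < y" for y
    unfolding r_def using fin that by (intro Min_le) auto
  have "\<not> (l < y \<and> y < r)" if "y \<in> S" for y
    using l_max[OF that] r_min[OF that] assms(2) that by (cases y x rule: linorder_cases) auto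
  then have "(l, r) \<in> gaps N S"
    using l r by (auto simp: mem_gaps)
  with l r that show ?thesis
    by blast
qed

lemma gap_around_unique:
  assumes "S \<subseteq> {1..N}" and "g \<in> gaps N S" and "h \<in> gaps N S"
    and "fst g < x" and "x < snd g" and "fst h < x" and "x < snd h"
  shows "g = h"
proof -
  \<comment> \<open>If \<open>a > a'\<close>, the occupied slot \<open>a\<close> would lie inside
    the second gap; if \<open>b > b'\<close>, then \<open>b'\<close> would lie inside the first. For
    two gaps around \<open>x\<close> this applies in both directions.\<close>
  have le: "a \<le> a' \<and> b \<le> b'"
    if ab: "(a, b) \<in> gaps N S" "(a', b') \<in> gaps N S" "a < b'" for a b a' b'
  proof -
    have "a \<le> a'"
      using that unfolding mem_gaps by (cases "a = 0") auto
    moreover have "b \<le> N + 1"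
      using assms(1) ab(1) unfolding mem_gaps by auto
    then have "b \<le> b'"
      using that unfolding mem_gaps by (cases "b' = N + 1") auto
    ultimately show ?thesis ..
  qed
  obtain l r l' r' where "g = (l, r)" "h = (l', r')"
    by (cases g, cases h)
  then show ?thesis
    using le[of l r l' r'] le[of l' r' l r] assms(2-) by auto
qed

text \<open>A new gap delimited by \<open>x\<close> must share its other end with the old gap around
  \<open>x\<close>. A new gap not delimited by \<open>x\<close> is an old gap that avoids
  \<open>x\<close>, and \<open>(l, r)\<close> is the only old gap that does not.\<close>

lemma gaps_insert:
  assumes "S \<subseteq> {1..N}" and "(l, r) \<in> gaps N S" and "l < x" and "x < r"
  shows "gaps N (insert x S) = insert (l, x) (insert (x, r) (gaps N S - {(l, r)}))"
    (is "?A = ?B")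
proof (rule set_eqI)
  fix g :: "nat \<times> nat"
  obtain l' r' where g: "g = (l', r')"
    by (cases g)
  have "r \<le> N + 1"
    using assms(1,2) by (auto simp: mem_gaps)
  have uniq: "(l', r') = (l, r)" if "(l', r') \<in> gaps N S" "l' < x" "x < r'"
    using gap_around_unique[OF assms(1) that(1) assms(2)] that assms(3,4) by simp
  have l: "l = 0 \<or> l \<in> S" and r: "r = N + 1 \<or> r \<in> S"
    using assms(2) unfolding mem_gaps by auto
  have free: "y \<le> l \<or> r \<le> y" "y \<le> N" if "y \<in> S" for y
    using assms(1,2) that unfolding mem_gaps by auto
  have "(l', x) \<in> ?A \<longleftrightarrow> l' = l"
  proof
    assume A: "(l', x) \<in> ?A"
    then have "l' \<le> l"
      using free(1)[of l'] assms(3,4) unfolding mem_gaps by auto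
    moreover have "l \<le> l'"
      using A l assms(3) unfolding mem_gaps by (cases "l = 0") auto
    ultimately show "l' = l"
      by simp
  next
    assume "l' = l"
    then show "(l', x) \<in> ?A"
      using l free(1) assms(3,4) unfolding mem_gaps by fastforce
  qed
  moreover have "(x, r') \<in> ?A \<longleftrightarrow> r' = r"
  proof
    assume A: "(x, r') \<in> ?A"
    then have "r \<le> r'"
      using free(1)[of r'] assms(3,4) \<open>r \<le> N + 1\<close> unfolding mem_gaps by auto
    moreover have "r' \<le> N + 1"
      using A free(2)[of r'] unfolding mem_gaps by auto
    then have "r' \<le> r"
      using A r assms(4) unfolding mem_gaps by (cases "r = N + 1") auto
    ultimately show "r' = r"
      by simp
  next
    assume "r' = r"
    then show "(x, r') \<in> ?A"
      using r free(1) assms(3,4) unfolding mem_gaps by fastforce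
  qed
  moreover have "(l', r') \<in> ?A \<longleftrightarrow> (l', r') \<in> gaps N S - {(l, r)}" if "l' \<noteq> x" "r' \<noteq> x"
  proof -
    have "(l', r') \<in> ?A \<longleftrightarrow> (l', r') \<in> gaps N S \<and> \<not> (l' < x \<and> x < r')"
      using that unfolding mem_gaps by blast
    also have "\<dots> \<longleftrightarrow> (l', r') \<in> gaps N S - {(l, r)}"
      using uniq assms(3,4) by blast
    finally show ?thesis .
  qed
  moreover have "x \<notin> S" "x \<noteq> 0" "x \<noteq> N + 1"
    using assms(2-4) \<open>r \<le> N + 1\<close> unfolding mem_gaps by auto
  then have "(l', x) \<notin> gaps N S" "(x, r') \<notin> gaps N S"
    unfolding mem_gaps by auto
  ultimately show "g \<in> ?A \<longleftrightarrow> g \<in> ?B"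
    unfolding g by (cases "l' = x"; cases "r' = x") auto
qed

text \<open>As \<open>x\<close> is neither occupied before nor a sentinel, it delimits no old gap,
  so both new pairs contribute fresh terms.\<close>

lemma sum_gaps_insert:
  fixes f :: "nat \<Rightarrow> real"
  assumes "S \<subseteq> {1..N}" and "(l, r) \<in> gaps N S" and "l < x" and "x < r"
  shows "(\<Sum>g\<in>gaps N (insert x S). f (gap_size g)) =
    (\<Sum>g\<in>gaps N S. f (gap_size g)) - f (r - l - 1) + f (x - l - 1) + f (r - x - 1)"
proof -
  have "r \<le> N + 1" "x \<notin> S" "x \<noteq> 0" "x \<noteq> N + 1"
    using assms unfolding mem_gaps by auto
  then have "(l, x) \<notin> gaps N S" "(x, r) \<notin> gaps N S"
    unfolding mem_gaps by auto
  then show ?thesis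
    unfolding gaps_insert[OF assms] using assms(2-4) finite_gaps[OF assms(1)]
    by (simp add: sum_diff1)
qed

section \<open>Admissible configurations and their available slots\<close>

definition parked :: "nat \<Rightarrow> nat \<Rightarrow> nat set \<Rightarrow> bool" where
  "parked k N S \<longleftrightarrow> S \<subseteq> {1..N} \<and> (\<forall>g\<in>gaps N S. k \<le> gap_size g)"

lemma parked_insert:
  assumes "parked k N S" and "x \<in> available k N S"
  shows "parked k N (insert x S)"
  using assms by (auto simp: parked_def available_def)

text \<open>The gaps away from \<open>x\<close> are unchanged and already long enough, so
  availability of \<open>x\<close> only requires \<open>k\<close> free slots on each side within its
  own gap.\<close>

lemma available_eq_UN:
  assumes "parked k N S"
  shows "available k N S = (\<Union>g\<in>gaps N S. {fst g + k<..<snd g - k})"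
proof (intro equalityI subsetI)
  have sub: "S \<subseteq> {1..N}"
    using assms by (simp add: parked_def)
  fix x
  {
    assume x: "x \<in> available k N S"
    then obtain l r where g: "(l, r) \<in> gaps N S" "l < x" "x < r"
      using gap_around_exists[OF sub] by (metis (no_types, lifting) available_def mem_Collect_eq)
    have "(l, x) \<in> gaps N (insert x S)" "(x, r) \<in> gaps N (insert x S)"
      unfolding gaps_insert[OF sub g] by auto
    with x have "k \<le> gap_size (l, x)" "k \<le> gap_size (x, r)"
      by (auto simp: available_def)
    with g show "x \<in> (\<Union>g\<in>gaps N S. {fst g + k<..<snd g - k})"
      by (intro UN_I[OF g(1)]) auto
  }
  {
    assume "x \<in> (\<Union>g\<in>gaps N S. {fst g + k<..<snd g - k})"
    then obtain l r where g: "(l, r) \<in> gaps N S" and "l + k < x" "x < r - k"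
      by auto
    then have x: "l < x" "x < r" and sizes: "k \<le> gap_size (l, x)" "k \<le> gap_size (x, r)"
      by auto
    have "x \<in> {1..N} - S"
      using g x sub by (auto simp: mem_gaps)
    then show "x \<in> available k N S"
      using assms sizes by (auto simp: available_def gaps_insert[OF sub g x] parked_def)
  }
qed

text \<open>The recursion of \<open>expected_gaps\<close> shifted by \<open>l\<close> and cleared of
  its denominator: splitting a gap at a uniform available slot preserves the expected count. For
  gaps of at most \<open>2 * k\<close> slots both sides vanish.\<close>

lemma sum_expected_gaps_split:
  assumes "l < r"
  shows "(\<Sum>x\<in>{l + k<..<r - k}. expected_gaps k q (x - l - 1) + expected_gaps k q (r - x - 1))
    = real (card {l + k<..<r - k}) * expected_gaps k q (r - l - 1)"
proof (cases "r - l - 1 \<le> 2 * k")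
  case True
  then have "{l + k<..<r - k} = {}"
    by auto
  then show ?thesis
    by simp
next
  case False
  have "(\<Sum>x\<in>{l + k<..<r - k}. expected_gaps k q (x - l - 1) + expected_gaps k q (r - x - 1))
    = (\<Sum>x\<in>{k<..<r - l - 1 + 1 - k}. expected_gaps k q (x - 1) + expected_gaps k q (r - l - 1 - x))"
    by (rule sum.reindex_bij_witness[of _ "\<lambda>x. x + l" "\<lambda>x. x - l"])
      (use assms False in \<open>auto simp: diff_right_commute\<close>)
  also have "\<dots> = real (r - l - 1 - 2 * k) * expected_gaps k q (r - l - 1)"
    using False by (subst (3) expected_gaps.simps) simp
  also have "r - l - 1 - 2 * k = card {l + k<..<r - k}"
    by simp
  finally show ?thesis .
qed

section \<open>Expected final count from an arbitrary admissible configuration\<close>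

lemma num_gaps_eq_sum:
  assumes "S \<subseteq> {1..N}"
  shows "real (num_gaps r N S) = (\<Sum>g\<in>gaps N S. of_bool (gap_size g = r))"
  using finite_gaps[OF assms] by (simp add: num_gaps_def sum.If_cases of_bool_def Int_def)

lemma finite_set_pmf_parking: "finite (set_pmf (parking k N S))"
proof (induction k N S rule: parking.induct)
  case (1 k N S)
  then show ?case
    by (subst parking.simps) (auto simp: set_pmf_of_set finite_available)
qed

text \<open>The sum on the right is a martingale along the process, since by
  \<open>sum_expected_gaps_split\<close> the effect of the next car averages to zero within each
  gap. At the end of the process it is the actual count.\<close>

lemma expectation_num_gaps:
  assumes "parked k N S"
  shows "measure_pmf.expectation (parking k N S) (\<lambda>T. real (num_gaps r N T)) =
    (\<Sum>g\<in>gaps N S. expected_gaps k r (gap_size g))"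
  using assms
proof (induction k N S rule: parking.induct)
  case (1 k N S)
  let ?A = "available k N S" and ?I = "\<lambda>g. {fst g + k<..<snd g - k}"
  let ?T = "\<Sum>g\<in>gaps N S. expected_gaps k r (gap_size g)"
  have sub: "S \<subseteq> {1..N}"
    using "1.prems" by (simp add: parked_def)
  note A = available_eq_UN[OF "1.prems"]
  show ?case
  proof (cases "?A = {}")
    case True
    have "expected_gaps k r (gap_size g) = of_bool (gap_size g = r)" if "g \<in> gaps N S" for g
    proof -
      obtain l s where g: "g = (l, s)"
        by (cases g)
      have "{l + k<..<s - k} = {}"
        using True that unfolding A g by fastforce
      \<comment> \<open>In truncated subtraction this cardinality is the gap size minus
        \<open>2 * k\<close>.\<close>
      then have "card {l + k<..<s - k} = 0"
        by simp
      then have "gap_size g \<le> 2 * k"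
        unfolding g by simp
      then show ?thesis
        by (simp add: expected_gaps.simps)
    qed
    then show ?thesis
      using True by (simp add: parking.simps num_gaps_eq_sum[OF sub])
  next
    case False
    have disj: "?I g \<inter> ?I h = {}" if "g \<in> gaps N S" "h \<in> gaps N S" "g \<noteq> h" for g h
    proof -
      have "g = h" if "x \<in> ?I g" "x \<in> ?I h" for x
        using that by (intro gap_around_unique[OF sub \<open>g \<in> gaps N S\<close> \<open>h \<in> gaps N S\<close>, of x]) auto
      then show ?thesis
        using \<open>g \<noteq> h\<close> by blast
    qed
    have "measure_pmf.expectation (parking k N S) (\<lambda>T. real (num_gaps r N T)) =
      (\<Sum>x\<in>?A. measure_pmf.expectation (parking k N (insert x S)) (\<lambda>T. real (num_gaps r N T)))
        / real (card ?A)"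
      using False
      by (subst parking.simps)
        (simp add: pmf_expectation_bind_pmf_of_set finite_available finite_set_pmf_parking
          sum_distrib_left divide_inverse_commute)
    also have "(\<Sum>x\<in>?A. measure_pmf.expectation (parking k N (insert x S))
        (\<lambda>T. real (num_gaps r N T))) =
      (\<Sum>x\<in>?A. \<Sum>g\<in>gaps N (insert x S). expected_gaps k r (gap_size g))"
      using False parked_insert[OF "1.prems"]
      by (intro sum.cong refl "1.IH") (auto simp: set_pmf_of_set finite_available)
    \<comment> \<open>The available slots are sorted by the gap that contains them; uniqueness of
      that gap makes the pieces disjoint.\<close>
    also have "\<dots> =
      (\<Sum>h\<in>gaps N S. \<Sum>x\<in>?I h. \<Sum>g\<in>gaps N (insert x S). expected_gaps k r (gap_size g))"
      unfolding A
    proof (rule sum.UNION_disjoint)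
      show "\<forall>g\<in>gaps N S. \<forall>h\<in>gaps N S. g \<noteq> h \<longrightarrow> ?I g \<inter> ?I h = {}"
        using disj by blast
    qed (simp_all add: finite_gaps[OF sub])
    also have "\<dots> = (\<Sum>h\<in>gaps N S. real (card (?I h)) * ?T)"
    proof (rule sum.cong[OF refl])
      fix h
      assume h: "h \<in> gaps N S"
      obtain l s where ls: "h = (l, s)"
        by (cases h)
      have "l < s"
        using h unfolding ls mem_gaps by simp
      have "(\<Sum>x\<in>?I h. \<Sum>g\<in>gaps N (insert x S). expected_gaps k r (gap_size g)) =
        (\<Sum>x\<in>{l + k<..<s - k}. ?T - expected_gaps k r (s - l - 1)
          + (expected_gaps k r (x - l - 1) + expected_gaps k r (s - x - 1)))"
        unfolding ls using h[unfolded ls]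
        by (intro sum.cong) (auto simp: sum_gaps_insert[OF sub])
      also have "\<dots> = real (card (?I h)) * ?T"
        by (subst sum.distrib, subst sum_expected_gaps_split[OF \<open>l < s\<close>])
          (simp add: ls algebra_simps)
      finally show "(\<Sum>x\<in>?I h. \<Sum>g\<in>gaps N (insert x S). expected_gaps k r (gap_size g))
        = real (card (?I h)) * ?T" .
    qed
    also have "\<dots> = real (\<Sum>h\<in>gaps N S. card (?I h)) * ?T"
      by (simp only: sum_distrib_right of_nat_sum)
    also have "(\<Sum>h\<in>gaps N S. card (?I h)) = card ?A"
      unfolding A
    proof (rule card_UN_disjoint[symmetric])
      show "\<forall>g\<in>gaps N S. \<forall>h\<in>gaps N S. g \<noteq> h \<longrightarrow> ?I g \<inter> ?I h = {}"
        using disj by blast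
    qed (simp_all add: finite_gaps[OF sub])
    finally show ?thesis
      using False by (simp add: finite_available)
  qed
qed

lemma a_seq_eq_expected_gaps:
  assumes "1 \<le> n"
  shows "a_seq k r n = expected_gaps k r (n + k - 1)"
proof -
  \<comment> \<open>The empty row is one gap of \<open>n + k - 1\<close> slots, which is admissible
    because \<open>1 \<le> n\<close>.\<close>
  have gaps: "gaps (n + k - 1) {} = {(0, n + k)}"
    using assms by (auto simp: gaps_def)
  then have "parked k (n + k - 1) {}"
    using assms by (simp add: parked_def)
  then show ?thesis
    unfolding a_seq_def by (subst expectation_num_gaps) (simp_all only: gaps, simp)
qed

section \<open>The recursion\<close>

text \<open>A row of \<open>n + 2 * k\<close> slots offers the first car exactly \<open>n\<close>
  slots. The left and the right remainder each run once through the rows with indices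
  \<open>1\<close> to \<open>n\<close>.\<close>

lemma a_seq_recursion:
  assumes "1 \<le> n"
  shows "real n * a_seq k r (n + k + 1) = 2 * s_seq k r n"
proof -
  have "real n * a_seq k r (n + k + 1) =
    (\<Sum>x\<in>{k<..<n + k + 1}. expected_gaps k r (x - 1) + expected_gaps k r (n + 2 * k - x))"
    using assms
    by (subst a_seq_eq_expected_gaps, simp, subst expected_gaps.simps) (simp add: mult_2 add.assoc)
  also have "\<dots> = (\<Sum>i=1..n. a_seq k r i + a_seq k r (n + 1 - i))"
    by (rule sum.reindex_bij_witness[of _ "\<lambda>i. i + k" "\<lambda>x. x - k"])
      (auto simp: a_seq_eq_expected_gaps intro!: arg_cong2[where f = "(+)"] arg_cong[where f = "expected_gaps k r"])
  also have "\<dots> = s_seq k r n + (\<Sum>i=1..n. a_seq k r (n + 1 - i))"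
    by (simp add: sum.distrib s_seq_def)
  also have "(\<Sum>i=1..n. a_seq k r (n + 1 - i)) = s_seq k r n"
    unfolding s_seq_def
    by (rule sum.reindex_bij_witness[of _ "\<lambda>i. n + 1 - i" "\<lambda>i. n + 1 - i"]) auto
  finally show ?thesis
    by simp
qed

lemma s_seq_eq: "s_seq k r n = real n * (real n + 2 * real k + 1) * t_seq k r n"
proof (cases "n = 0")
  case False
  then have "real (n * (n + 2 * k + 1)) \<noteq> 0"
    by (simp only: of_nat_eq_0_iff) simp
  then have "real (n * (n + 2 * k + 1)) * t_seq k r n = s_seq k r n"
    unfolding t_seq_def times_divide_eq_right by (rule nonzero_mult_div_cancel_left)
  then show ?thesis
    by (simp add: algebra_simps)
qed (simp add: s_seq_def)

lemma sum_u_seq: "(\<Sum>i<m. u_seq k r (n + 1 + i)) = t_seq k r (n + m) - t_seq k r n"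
  by (induction m) (simp_all add: u_seq_def)

lemma u_seq_recursion:
  assumes "1 \<le> n"
  shows "(real n + real k + 1) * (real n + 3 * real k + 2) * u_seq k r (n + k + 1) =
    - 2 * (real n + 2 * real k + 1) * (\<Sum>i<k. u_seq k r (n + 1 + i))"
proof -
  define N K where "N = real n" and "K = real k"
  let ?t = "t_seq k r"
  have "N \<noteq> 0"
    using assms by (simp add: N_def)
  have "s_seq k r (n + k + 1) - s_seq k r (n + k) = a_seq k r (n + k + 1)"
    by (simp add: s_seq_def)
  then have "N * (s_seq k r (n + k + 1) - s_seq k r (n + k)) = 2 * s_seq k r n"
    using a_seq_recursion[OF assms] by (simp add: N_def)
  then have "N * ((N + K + 1) * (N + 3 * K + 2) * ?t (n + k + 1)
      - (N + K) * (N + 3 * K + 1) * ?t (n + k)) = N * (2 * (N + 2 * K + 1) * ?t n)"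
    unfolding s_seq_eq by (simp add: N_def K_def algebra_simps)
  \<comment> \<open>The factor \<open>N\<close> that cancels on the right comes from
    \<open>s_seq k r n\<close> containing \<open>n\<close>.\<close>
  then have "(N + K + 1) * (N + 3 * K + 2) * ?t (n + k + 1)
      - (N + K) * (N + 3 * K + 1) * ?t (n + k) = 2 * (N + 2 * K + 1) * ?t n"
    using \<open>N \<noteq> 0\<close> by simp
  \<comment> \<open>Constant \<open>?t\<close> solves the equation because \<open>(N + K) * (N + 3 *
    K + 1) + 2 * (N + 2 * K + 1) = (N + K + 1) * (N + 3 * K + 2)\<close>, so only differences of
    \<open>?t\<close> remain.\<close>
  then have "(N + K + 1) * (N + 3 * K + 2) * (?t (n + k + 1) - ?t (n + k)) =
      - 2 * (N + 2 * K + 1) * (?t (n + k) - ?t n)"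
    by algebra
  then show ?thesis
    unfolding sum_u_seq by (simp add: u_seq_def N_def K_def)
qed

section \<open>The estimates\<close>

text \<open>With \<open>N = n + k + 1\<close> the recursion has coefficient
  \<open>2 * (N + k) / (N * (N + 2 * k + 1))\<close>, which is at most \<open>2 / N\<close>, in
  front of a sum of \<open>k\<close> terms.\<close>

lemma abs_u_seq_step:
  assumes "k + 2 \<le> N" and "\<And>m. N - k \<le> m \<Longrightarrow> m < N \<Longrightarrow> \<bar>u_seq k r m\<bar> \<le> B"
  shows "\<bar>u_seq k r N\<bar> \<le> 2 * real k / real N * B"
proof -
  define n where "n = N - k - 1"
  have n: "1 \<le> n" "N = n + k + 1"
    using assms(1) by (auto simp: n_def)
  define x y z where "x = real N" and "y = real N + 2 * real k + 1" and "z = real N + real k"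
  have pos: "0 < x" "0 < y" "0 \<le> z" "z \<le> y"
    using assms(1) by (auto simp: x_def y_def z_def)
  define U where "U = (\<Sum>i<k. u_seq k r (n + 1 + i))"
  have "x * y * u_seq k r N = - 2 * z * U"
    using u_seq_recursion[OF n(1), of k r] unfolding U_def x_def y_def z_def n(2)
    by (simp add: algebra_simps)
  then have "\<bar>x * y * u_seq k r N\<bar> = \<bar>- 2 * z * U\<bar>"
    by (rule arg_cong)
  then have "x * y * \<bar>u_seq k r N\<bar> = 2 * z * \<bar>U\<bar>"
    using pos by (simp add: abs_mult)
  also have "\<dots> \<le> 2 * y * \<bar>U\<bar>"
    using pos by (intro mult_right_mono) auto
  finally have "y * (x * \<bar>u_seq k r N\<bar>) \<le> y * (2 * \<bar>U\<bar>)"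
    by (simp add: mult_ac)
  then have "x * \<bar>u_seq k r N\<bar> \<le> 2 * \<bar>U\<bar>"
    using pos by simp
  also have "\<bar>U\<bar> \<le> (\<Sum>i<k. \<bar>u_seq k r (n + 1 + i)\<bar>)"
    unfolding U_def by (rule sum_abs)
  also have "\<dots> \<le> (\<Sum>i<k. B)"
    by (intro sum_mono assms(2)) (auto simp: n)
  finally show ?thesis
    using pos by (simp add: x_def field_simps)
qed

lemma abs_u_seq_le_M_const:
  assumes "1 \<le> k" and "2 \<le> N"
  shows "\<bar>u_seq k r N\<bar> \<le> M_const k r"
  using assms(2)
proof (induction N rule: less_induct)
  case (less N)
  show ?case
  proof (cases "N \<le> 2 * k")
    case True
    then show ?thesis
      unfolding M_const_def using less.prems by (intro Max_ge) auto
  next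
    \<comment> \<open>Beyond \<open>2 * k\<close> the factor \<open>2 * k / N\<close> is below 1,
      and the \<open>k\<close> preceding indices are still at least 2.\<close>
    case False
    have "0 \<le> M_const k r"
      using assms(1) unfolding M_const_def
      by (intro order.trans[OF abs_ge_zero Max_ge[of _ "\<bar>u_seq k r 2\<bar>"]]) auto
    have "\<bar>u_seq k r N\<bar> \<le> 2 * real k / real N * M_const k r"
      using False assms(1) by (intro abs_u_seq_step less.IH) auto
    also have "\<dots> \<le> 1 * M_const k r"
      using False \<open>0 \<le> M_const k r\<close> by (intro mult_right_mono) auto
    finally show ?thesis
      by simp
  qed
qed

lemma M_const_nonneg:
  assumes "1 \<le> k"
  shows "0 \<le> M_const k r"
  using abs_u_seq_le_M_const[OF assms, of 2 r] abs_ge_zero[of "u_seq k r 2"] by linarith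

text \<open>If \<open>N \<ge> (p + 1) * k + 2\<close>, the \<open>k\<close> preceding indices are at
  least \<open>p * k + 2\<close>, so the bound for \<open>p\<close> holds there; the step then
  contributes \<open>2 * k / N \<le> 2 / (p + 1)\<close>.\<close>

lemma abs_u_seq_le:
  assumes "1 \<le> k" and "p * k + 2 \<le> N"
  shows "\<bar>u_seq k r N\<bar> \<le> M_const k r * (2 ^ p / fact p)"
  using assms(2)
proof (induction p arbitrary: N)
  case 0
  then show ?case
    using abs_u_seq_le_M_const[OF assms(1)] by simp
next
  case (Suc p)
  let ?B = "M_const k r * (2 ^ p / fact p)"
  have "\<bar>u_seq k r N\<bar> \<le> 2 * real k / real N * ?B"
    using Suc.prems by (intro abs_u_seq_step Suc.IH) auto
  also have "\<dots> \<le> 2 / real (Suc p) * ?B"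
  proof (rule mult_right_mono)
    have "real (Suc p) * real k \<le> real N"
      using Suc.prems by (simp only: of_nat_mult[symmetric] of_nat_le_iff)
    moreover have "0 < real N"
      using Suc.prems by simp
    ultimately show "2 * real k / real N \<le> 2 / real (Suc p)"
      by (simp add: field_simps)
    show "0 \<le> ?B"
      using M_const_nonneg[OF assms(1)] by simp
  qed
  finally show ?case
    by (simp add: field_simps)
qed

section \<open>Summation of the tail\<close>

lemma power_over_fact_le:
  fixes x :: real
  assumes "0 \<le> x"
  shows "x ^ (p + j) / fact (p + j) \<le> x ^ p / fact p * (x ^ j / fact j)"
proof -
  have "fact p * fact j \<le> (fact (p + j) :: real)"
  proof -
    have "real (fact p * fact j) \<le> real (fact (p + j))"
      by (intro of_nat_mono dvd_imp_le fact_fact_dvd_fact) simp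
    then show ?thesis
      by simp
  qed
  then have "x ^ (p + j) / fact (p + j) \<le> x ^ (p + j) / (fact p * fact j)"
    using assms by (intro divide_left_mono) auto
  then show ?thesis
    by (simp add: power_add)
qed

lemma sums_exp_real: "(\<lambda>j. x ^ j / fact j) sums exp (x :: real)"
  using exp_converges[of x] by (simp add: divide_inverse_commute)

text \<open>In the \<open>j\<close>-th block of \<open>k\<close> terms all indices are at least
  \<open>(p + j) * k + 2\<close>. Splitting off \<open>2 ^ p / fact p\<close> leaves the exponential
  series at 2; the block length gives the factor \<open>k\<close>. The bound is uniform in
  \<open>m\<close>, hence yields both convergence and the tail estimate.\<close>

lemma sum_abs_u_seq_le:
  assumes "1 \<le> k" and "2 \<le> s"
  shows "(\<Sum>i<m. \<bar>u_seq k r (p * k + s + i)\<bar>) \<le>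
    M_const k r * real k * (exp 1)\<^sup>2 * 2 ^ p / fact p" (is "_ \<le> ?C")
proof -
  let ?M = "M_const k r" and ?e = "\<lambda>j. 2 ^ j / fact j :: real"
  \<comment> \<open>Nonnegative terms are added to fill \<open>m\<close> whole blocks.\<close>
  have "(\<Sum>i<m. \<bar>u_seq k r (p * k + s + i)\<bar>) \<le> (\<Sum>i<m * k. \<bar>u_seq k r (p * k + s + i)\<bar>)"
    using assms(1) by (intro sum_mono2) (auto intro: less_le_trans)
  also have "\<dots> = (\<Sum>j<m. \<Sum>i\<in>{j * k..<j * k + k}. \<bar>u_seq k r (p * k + s + i)\<bar>)"
    by (simp add: sum.nat_group)
  also have "\<dots> \<le> (\<Sum>j<m. \<Sum>i\<in>{j * k..<j * k + k}. ?M * (?e p * ?e j))"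
  proof (intro sum_mono)
    fix j i
    assume "i \<in> {j * k..<j * k + k}"
    then have "\<bar>u_seq k r (p * k + s + i)\<bar> \<le> ?M * ?e (p + j)"
      using assms by (intro abs_u_seq_le) (auto simp: algebra_simps)
    also have "\<dots> \<le> ?M * (?e p * ?e j)"
      using M_const_nonneg[OF assms(1)] by (intro mult_left_mono power_over_fact_le) auto
    finally show "\<bar>u_seq k r (p * k + s + i)\<bar> \<le> ?M * (?e p * ?e j)" .
  qed
  also have "\<dots> = ?M * real k * ?e p * (\<Sum>j<m. ?e j)"
    by (simp add: sum_distrib_left sum_divide_distrib mult_ac)
  also have "\<dots> \<le> ?M * real k * ?e p * exp 2"
  proof (rule mult_left_mono)
    have "(\<Sum>j<m. ?e j) \<le> (\<Sum>j. ?e j)"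
      using sums_exp_real[of 2] by (intro sum_le_suminf) (auto simp: sums_iff)
    then show "(\<Sum>j<m. ?e j) \<le> exp 2"
      using sums_exp_real[of 2] by (simp add: sums_iff)
  qed (use M_const_nonneg[OF assms(1)] in simp)
  also have "\<dots> = ?C"
    by (simp flip: exp_double)
  finally show ?thesis .
qed

theorem corollary3p8:
  fixes k r :: nat
  assumes "1 \<le> k" and "k \<le> r" and "r \<le> 2 * k"
  shows "summable (\<lambda>i. \<bar>u_seq k r (2 + i)\<bar>) \<and>
         t_seq k r \<longlonglongrightarrow> t_inf k r \<and>
         t_inf k r = s_seq k r 1 / real (2 * k + 2) + (\<Sum>i. u_seq k r (2 + i)) \<and>
         (\<forall>n\<ge>2. error_term k r n = t_inf k r - t_seq k r (n - 1) \<and>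
            (\<forall>p s. n = p * k + s \<longrightarrow> 2 \<le> s \<longrightarrow> s \<le> k + 1 \<longrightarrow>
               \<bar>error_term k r n\<bar> \<le> M_const k r * real k * (exp 1)\<^sup>2 * 2 ^ p / fact p))"
proof -
  \<comment> \<open>The uniform bound with \<open>p = 0\<close>, where \<open>2 ^ p / fact p\<close>
    is 1.\<close>
  have summ: "summable (\<lambda>i. \<bar>u_seq k r (s + i)\<bar>)" if "2 \<le> s" for s
    using sum_abs_u_seq_le[OF assms(1) that, where p = 0]
    by (intro summableI_nonneg_bounded[where x = "M_const k r * real k * (exp 1)\<^sup>2"]) auto
  have partial_sums: "(\<lambda>m. t_seq k r (m + (n - 1))) \<longlonglongrightarrow> t_seq k r (n - 1) + error_term k r n"
    if "2 \<le> n" for n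
  proof -
    have "(\<lambda>m. \<Sum>i<m. u_seq k r (n + i)) \<longlonglongrightarrow> error_term k r n"
      unfolding error_term_def
      by (rule summable_LIMSEQ[OF summable_rabs_cancel[OF summ[OF that]]])
    moreover have "t_seq k r (m + (n - 1)) = t_seq k r (n - 1) + (\<Sum>i<m. u_seq k r (n + i))" for m
      using sum_u_seq[of k r "n - 1" m] that by (simp add: add.commute[of m])
    ultimately show ?thesis
      by (simp add: tendsto_add)
  qed
  have tail_limit: "t_seq k r \<longlonglongrightarrow> t_seq k r (n - 1) + error_term k r n" if "2 \<le> n" for n
    by (rule LIMSEQ_offset[OF partial_sums[OF that]])
  \<comment> \<open>Uniqueness of limits identifies \<open>t_inf\<close>, defined by
    \<open>lim\<close>, for every starting index at once.\<close>
  have t_inf: "t_inf k r = t_seq k r (n - 1) + error_term k r n" if "2 \<le> n" for n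
    unfolding t_inf_def using tail_limit[OF that] by (rule limI)
  have "t_seq k r \<longlonglongrightarrow> t_inf k r"
    using tail_limit[of 2] t_inf[of 2] by simp
  \<comment> \<open>The case \<open>n = 2\<close>: the denominator of \<open>t_seq k r 1\<close> is
    \<open>1 * (1 + 2 * k + 1)\<close>.\<close>
  moreover have "t_inf k r = s_seq k r 1 / real (2 * k + 2) + (\<Sum>i. u_seq k r (2 + i))"
    using t_inf[of 2] by (simp add: t_seq_def error_term_def)
  moreover have "\<bar>error_term k r (p * k + s)\<bar> \<le> M_const k r * real k * (exp 1)\<^sup>2 * 2 ^ p / fact p"
    if "2 \<le> s" for p s
  proof -
    have summ': "summable (\<lambda>i. \<bar>u_seq k r (p * k + s + i)\<bar>)"
      using that by (intro summ) simp
    have "\<bar>error_term k r (p * k + s)\<bar> \<le> (\<Sum>i. \<bar>u_seq k r (p * k + s + i)\<bar>)"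
      unfolding error_term_def by (rule summable_rabs[OF summ'])
    also have "\<dots> \<le> M_const k r * real k * (exp 1)\<^sup>2 * 2 ^ p / fact p"
      using summ' by (intro suminf_le_const sum_abs_u_seq_le assms(1) that)
    finally show ?thesis .
  qed
  ultimately show ?thesis
    using summ[of 2] t_inf by auto
qed

end
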